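(* Let $n\ge 2$, $\mathbf{x}\in[0,1]^n$, $H\in\mathbb{R}^{n\times n}$, $\gamma>0$, $\delta=\epsilon\,\mathbf{1}^\top\mathbf{x}>0$, and let $C\in\mathbb{R}^{n\times n}$ be a cost matrix with nonnegative entries and $C_{ij}=0\Leftrightarrow i=j$. Any solution $\lambda^\star$ of $$\max_{\lambda\ge0}\ -\lambda\delta+\gamma\sum_{i:\,x_i>0}x_i\log x_i-\gamma\sum_{i=1}^n x_i\log\sum_{j=1}^n\exp\left(-\frac{H_{ij}+\lambda C_{ij}}{\gamma}\right)$$ satisfies $$0\le\lambda^\star\le\frac{\left[\,2\,\|\mathrm{vec}(H)\|_\infty+\gamma\log\left(\frac1\delta\,\mathbf{x}^\top C\mathbf{1}\right)\right]_+}{\min_{i\ne j}\{C_{ij}\}}.$$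
   Context: $\mathbf{1}\in\mathbb{R}^n$ is the all-ones vector; $\|\mathrm{vec}(H)\|_\infty=\max_{i,j}|H_{ij}|$; $[t]_+=\max\{t,0\}$. $\epsilon>0$ is a scalar. *)

theory Defs
  imports "HOL-Analysis.Analysis"
begin

definition vec_max_norm :: "real ^ 'n ^ 'n \<Rightarrow> real" where
  "vec_max_norm H = Max {\<bar>H $ i $ j\<bar> | i j. True}"

definition min_offdiag :: "real ^ 'n ^ 'n \<Rightarrow> real" where
  "min_offdiag C = Min {C $ i $ j | i j. i \<noteq> j}"

definition pos_part :: "real \<Rightarrow> real" where
  "pos_part t = max t 0"

definition dual_objective ::
  "real ^ 'n \<Rightarrow> real ^ 'n ^ 'n \<Rightarrow> real ^ 'n ^ 'n \<Rightarrow> real \<Rightarrow> real \<Rightarrow> real \<Rightarrow> real" where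
  "dual_objective x H C \<gamma> \<delta> l =
     - l * \<delta> + \<gamma> * (\<Sum>i | x $ i > 0. x $ i * ln (x $ i))
     - \<gamma> * (\<Sum>i\<in>UNIV. x $ i * ln (\<Sum>j\<in>UNIV. exp (- (H $ i $ j + l * C $ i $ j) / \<gamma>)))"

end

theory Submission
  imports Defs
begin

text \<open>At a positive maximiser the derivative of the dual objective vanishes, so \<open>\<delta>\<close> equals
  \<open>\<Sum>i j. x\<^sub>i C\<^sub>i\<^sub>j p\<^sub>i\<^sub>j\<close>, where \<open>p\<^sub>i\<close> is the Gibbs distribution with weights \<open>exp (- (H\<^sub>i\<^sub>j + \<lambda> C\<^sub>i\<^sub>j) / \<gamma>)\<close>.
  Since \<open>C\<^sub>i\<^sub>i = 0\<close>, comparing the weight of \<open>j \<noteq> i\<close> with that of \<open>i\<close> gives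
  \<open>p\<^sub>i\<^sub>j \<le> exp ((2 \<parallel>H\<parallel> - \<lambda> min C) / \<gamma>)\<close>, and taking logarithms bounds \<open>\<lambda>\<close>.\<close>

lemma finite_offdiag: "finite {C $ i $ j | i j. i \<noteq> j}" for C :: "'a ^ 'n ^ 'n"
proof (rule finite_subset)
  show "{C $ i $ j | i j. i \<noteq> j} \<subseteq> (\<lambda>(i, j). C $ i $ j) ` UNIV" by auto
qed simp

lemma min_offdiag_le: "i \<noteq> j \<Longrightarrow> min_offdiag C \<le> C $ i $ j"
  unfolding min_offdiag_def by (rule Min_le) (auto simp: finite_offdiag)

lemma min_offdiag_pos:
  fixes C :: "real ^ 'n ^ 'n"
  assumes "CARD('n) \<ge> 2" "\<And>i j. i \<noteq> j \<Longrightarrow> C $ i $ j > 0"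
  shows "min_offdiag C > 0"
proof -
  \<comment> \<open>Two distinct indices make the set of off-diagonal entries nonempty, so that
    \<open>Min\<close> is attained by one of them.\<close>
  obtain i j :: 'n where "i \<noteq> j"
    using assms(1) by (meson UNIV_I card_2_iff' ex_card)
  then have "{C $ i $ j | i j. i \<noteq> j} \<noteq> {}" by blast
  then show ?thesis
    unfolding min_offdiag_def using assms(2) by (subst Min_gr_iff) (auto simp: finite_offdiag)
qed

lemma abs_le_vec_max_norm: "\<bar>H $ i $ j\<bar> \<le> vec_max_norm H"
  unfolding vec_max_norm_def
proof (rule Max_ge)
  have "{\<bar>H $ i $ j\<bar> | i j. True} = (\<lambda>(i, j). \<bar>H $ i $ j\<bar>) ` UNIV" by auto
  then show "finite {\<bar>H $ i $ j\<bar> | i j. True}" by simp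
qed blast

definition gibbs :: "real ^ 'n ^ 'n \<Rightarrow> real ^ 'n ^ 'n \<Rightarrow> real \<Rightarrow> real \<Rightarrow> 'n \<Rightarrow> 'n \<Rightarrow> real" where
  "gibbs H C \<gamma> l i j = exp (- (H $ i $ j + l * C $ i $ j) / \<gamma>) /
     (\<Sum>k\<in>UNIV. exp (- (H $ i $ k + l * C $ i $ k) / \<gamma>))"

text \<open>Each log-sum-exp has as derivative minus the \<open>gibbs\<close> mean of row
  \<open>i\<close> of \<open>C\<close>, divided by \<gamma>; the outer factor \<gamma> cancels that
  division.\<close>

lemma dual_objective_has_derivative:
  fixes x :: "real ^ 'n"
  assumes "\<gamma> \<noteq> 0"
  shows "(dual_objective x H C \<gamma> \<delta> has_real_derivative
    (\<Sum>i\<in>UNIV. x $ i * (\<Sum>j\<in>UNIV. C $ i $ j * gibbs H C \<gamma> l i j)) - \<delta>) (at l)"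
proof -
  let ?E = "\<lambda>l i j. exp (- (H $ i $ j + l * C $ i $ j) / \<gamma>)"
  have E: "((\<lambda>l. ?E l i j) has_real_derivative - (?E l i j * C $ i $ j / \<gamma>)) (at l)" for i j
    using assms by (auto intro!: derivative_eq_intros)
  have S: "(\<Sum>j\<in>UNIV. ?E l i j) > 0" for i
    by (intro sum_pos) auto
  have L: "((\<lambda>l. ln (\<Sum>j\<in>UNIV. ?E l i j)) has_real_derivative
      - (\<Sum>j\<in>UNIV. C $ i $ j * gibbs H C \<gamma> l i j) / \<gamma>) (at l)" for i
  proof -
    have "((\<lambda>l. ln (\<Sum>j\<in>UNIV. ?E l i j)) has_real_derivative
        inverse (\<Sum>j\<in>UNIV. ?E l i j) * (\<Sum>j\<in>UNIV. - (?E l i j * C $ i $ j / \<gamma>))) (at l)"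
      by (rule DERIV_chain2[OF DERIV_ln[OF S] DERIV_sum[OF E]])
    also have "inverse (\<Sum>j\<in>UNIV. ?E l i j) * (\<Sum>j\<in>UNIV. - (?E l i j * C $ i $ j / \<gamma>)) =
        - (\<Sum>j\<in>UNIV. C $ i $ j * gibbs H C \<gamma> l i j) / \<gamma>"
      by (simp add: gibbs_def sum_negf sum_distrib_left sum_divide_distrib field_simps)
    finally show ?thesis .
  qed
  \<comment> \<open>The summand \<open>0\<close> comes from the entropy of \<open>x\<close>, which
    is constant in \<open>l\<close>.\<close>
  have "(dual_objective x H C \<gamma> \<delta> has_real_derivative
      - 1 * \<delta> + 0 - \<gamma> * (\<Sum>i\<in>UNIV. x $ i * (- (\<Sum>j\<in>UNIV. C $ i $ j * gibbs H C \<gamma> l i j) / \<gamma>))) (at l)"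
    unfolding dual_objective_def[abs_def]
    by (intro DERIV_diff DERIV_add DERIV_const DERIV_cmult DERIV_sum L DERIV_cmult_right
        DERIV_minus DERIV_ident)
  also have "- 1 * \<delta> + 0 - \<gamma> * (\<Sum>i\<in>UNIV. x $ i * (- (\<Sum>j\<in>UNIV. C $ i $ j * gibbs H C \<gamma> l i j) / \<gamma>))
      = (\<Sum>i\<in>UNIV. x $ i * (\<Sum>j\<in>UNIV. C $ i $ j * gibbs H C \<gamma> l i j)) - \<delta>"
    using assms by (simp add: sum_distrib_left sum_divide_distrib sum_negf)
  finally show ?thesis .
qed

text \<open>The normalising sum is at least its diagonal term, which is free of \<open>l\<close>
  because \<open>C $ i $ i = 0\<close>. The factor 2 pays for the two entries of \<open>H\<close>
  left in the ratio of weights.\<close>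

lemma gibbs_offdiag_le:
  fixes H C :: "real ^ 'n ^ 'n"
  assumes "\<gamma> > 0" "l \<ge> 0" "C $ i $ i = 0" "i \<noteq> j"
  shows "gibbs H C \<gamma> l i j \<le> exp ((2 * vec_max_norm H - l * min_offdiag C) / \<gamma>)"
proof -
  let ?E = "\<lambda>j. exp (- (H $ i $ j + l * C $ i $ j) / \<gamma>)"
  have "?E i \<le> (\<Sum>k\<in>UNIV. ?E k)"
    by (rule member_le_sum) auto
  then have "gibbs H C \<gamma> l i j \<le> ?E j / ?E i"
    unfolding gibbs_def by (intro divide_left_mono mult_pos_pos sum_pos) auto
  also have "\<dots> = exp ((H $ i $ i - H $ i $ j - l * C $ i $ j) / \<gamma>)"
    using assms(3) by (simp flip: exp_diff add: diff_divide_distrib add_divide_distrib)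
  also have "\<dots> \<le> exp ((2 * vec_max_norm H - l * min_offdiag C) / \<gamma>)"
    using abs_le_vec_max_norm[of H i i] abs_le_vec_max_norm[of H i j] assms(1)
      mult_left_mono[OF min_offdiag_le[OF assms(4), of C] assms(2)]
    by (simp add: divide_right_mono)
  finally show ?thesis .
qed

theorem proposition8:
  fixes x :: "real ^ 'n"
    and H C :: "real ^ 'n ^ 'n"
    and \<gamma> \<delta> \<epsilon> lstar :: real
  assumes "CARD('n) \<ge> 2"
    and "\<forall>i. x $ i \<in> {0..1}"
    and "\<gamma> > 0"
    and "\<epsilon> > 0"
    and "\<delta> = \<epsilon> * (1 \<bullet> x)"
    and "\<delta> > 0"
    and "\<forall>i j. C $ i $ j \<ge> 0"
    and "\<forall>i j. C $ i $ j = 0 \<longleftrightarrow> i = j"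
    and "is_arg_max (dual_objective x H C \<gamma> \<delta>) (\<lambda>l. l \<ge> 0) lstar"
  shows "0 \<le> lstar \<and>
    lstar \<le> pos_part (2 * vec_max_norm H + \<gamma> * ln (1 / \<delta> * (x \<bullet> (C *v 1)))) / min_offdiag C"
proof -
  let ?F = "dual_objective x H C \<gamma> \<delta>" and ?m = "min_offdiag C"
  let ?t = "2 * vec_max_norm H + \<gamma> * ln (1 / \<delta> * (x \<bullet> (C *v 1)))"
  have m: "?m > 0"
    using assms(1,7,8) by (intro min_offdiag_pos) (auto simp: less_le)
  have nonneg: "lstar \<ge> 0" and max: "\<And>y. y \<ge> 0 \<Longrightarrow> ?F y \<le> ?F lstar"
    using assms(9) by (auto simp: is_arg_max_def not_less)
  have "lstar * ?m \<le> pos_part ?t"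
  \<comment> \<open>At the boundary point 0 the derivative need not vanish, but there the bound only
    says that \<open>pos_part\<close> is nonnegative.\<close>
  proof (cases "lstar = 0")
    case True
    then show ?thesis by (simp add: pos_part_def)
  next
    case False
    with nonneg have pos: "lstar > 0" by simp
    let ?e = "exp ((2 * vec_max_norm H - lstar * ?m) / \<gamma>)"
    have "(\<Sum>i\<in>UNIV. x $ i * (\<Sum>j\<in>UNIV. C $ i $ j * gibbs H C \<gamma> lstar i j)) - \<delta> = 0"
    proof (rule DERIV_local_max[OF dual_objective_has_derivative pos])
      \<comment> \<open>The radius \<open>lstar\<close> keeps \<open>y\<close> positive, hence
        feasible.\<close>
      show "\<forall>y. \<bar>lstar - y\<bar> < lstar \<longrightarrow> ?F y \<le> ?F lstar"
        using max by auto
    qed (use assms(3) in simp)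
    then have "\<delta> = (\<Sum>i\<in>UNIV. x $ i * (\<Sum>j\<in>UNIV. C $ i $ j * gibbs H C \<gamma> lstar i j))"
      by simp
    also have "\<dots> \<le> (\<Sum>i\<in>UNIV. x $ i * (\<Sum>j\<in>UNIV. C $ i $ j * ?e))"
    proof (rule sum_mono, rule mult_left_mono, rule sum_mono)
      fix i j
      have "C $ i $ i = 0" using assms(8) by blast
      \<comment> \<open>On the diagonal both sides vanish, so the off-diagonal bound on
        \<open>gibbs\<close> suffices.\<close>
      then show "C $ i $ j * gibbs H C \<gamma> lstar i j \<le> C $ i $ j * ?e"
        using gibbs_offdiag_le[of \<gamma> lstar C i j H] assms(3,7) nonneg
        by (cases "i = j") (auto intro: mult_left_mono)
      show "0 \<le> x $ i" using assms(2) by auto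
    qed
    also have "\<dots> = ?e * (x \<bullet> (C *v 1))"
      by (simp add: inner_vec_def matrix_vector_mult_def sum_distrib_left sum_distrib_right ac_simps)
    finally have le: "\<delta> \<le> ?e * (x \<bullet> (C *v 1))" .
    \<comment> \<open>Positivity of the total cost is extracted from \<delta> > 0 here; it allows
      \<open>ln\<close> to split the product and the quotient below.\<close>
    with assms(6) have "0 < ?e * (x \<bullet> (C *v 1))" by linarith
    then have q: "x \<bullet> (C *v 1) > 0"
      by (simp add: zero_less_mult_iff)
    have "ln \<delta> \<le> ln (?e * (x \<bullet> (C *v 1)))"
      using le assms(6) by simp
    also have "\<dots> = (2 * vec_max_norm H - lstar * ?m) / \<gamma> + ln (x \<bullet> (C *v 1))"
      using q by (simp add: ln_mult)
    finally have "lstar * ?m \<le> ?t"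
      using q assms(3,6) by (simp add: ln_div field_simps)
    then show ?thesis by (simp add: pos_part_def)
  qed
  with nonneg m show ?thesis by (simp add: pos_le_divide_eq)
qed

end
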